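(* Let $0<q\le\infty$, and let $\Phi$ be a Young function in $\nabla_2$. Then the Hardy-Littlewood maximal operator $M$ is bounded on $L^{\Phi,q}(\mathbb{R}^n)$, i.e. there is a constant $C>0$ such that $\|Mf\|_{L^{\Phi,q}}\le C\|f\|_{L^{\Phi,q}}$ for all $f\in L^{\Phi,q}(\mathbb{R}^n)$. In particular, $M$ is bounded on ${\rm w}L^\Phi(\mathbb{R}^n)$, i.e. there is a constant $C>0$ such that $\|Mf\|_{{\rm w}L^\Phi}\le C\|f\|_{{\rm w}L^\Phi}$ for all $f\in{\rm w}L^\Phi(\mathbb{R}^n)$.
   Context: For $\Phi:[0,\infty]\to[0,\infty]$ put $a(\Phi)=\sup\{t\ge0:\Phi(t)=0\}$ and $b(\Phi)=\inf\{t\ge0:\Phi(t)=\infty\}$, with $\inf\emptyset=\infty$. An increasing (i.e. non-decreasing) function $\Phi:[0,\infty]\to[0,\infty]$ is a Young function if: (1) $0\le a(\Phi)<\infty$ and $0<b(\Phi)\le\infty$; (2) $\lim_{t\to0}\Phi(t)=\Phi(0)=0$; (3) $\Phi$ is convex on $[0,b(\Phi))$; (4) if $b(\Phi)=\infty$ then $\lim_{t\to\infty}\Phi(t)=\Phi(\infty)=\infty$; (5) if $b(\Phi)<\infty$ then $\lim_{t\to b(\Phi)-0}\Phi(t)=\Phi(b(\Phi))$. $\Phi\in\nabla_2$ means that for some $k>1$, $\Phi(r)\le\frac1{2k}\Phi(kr)$ for all $r\ge0$. The generalized inverse is $\Phi^{-1}(u)=\inf\{t\ge0:\Phi(t)>u\}$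 for $u\in[0,\infty)$ and $\Phi^{-1}(\infty)=\infty$; $\Phi^{-1}(u)^{-1}$ denotes the reciprocal $1/\Phi^{-1}(u)$. For a measurable function $f$ on $\mathbb{R}^n$ and $t>0$, $m(f,t)=|\{x\in\mathbb{R}^n:|f(x)|>t\}|$ and $f^\ast(t)=\inf\{\alpha>0:m(f,\alpha)\le t\}$ (with $\inf\emptyset=\infty$). $L^{\Phi,q}(\mathbb{R}^n)$ (Orlicz-Lorentz space) is the set of measurable $f$ with $\|f\|_{L^{\Phi,q}}<\infty$, where $\|f\|_{L^{\Phi,q}}=\left(\int_0^\infty[\Phi^{-1}(1/t)^{-1}f^\ast(t)]^q\frac{dt}t\right)^{1/q}$ if $0<q<\infty$ and $\|f\|_{L^{\Phi,\infty}}=\sup_{t>0}\Phi^{-1}(1/t)^{-1}f^\ast(t)$. ${\rm w}L^\Phi(\mathbb{R}^n)$ is the set of measurable $f$ with $\sup_{t>0}\Phi(t)m(kf,t)<\infty$ for some $k>0$, and $\|f\|_{{\rm w}L^\Phi}=\inf\{\lambda>0:\sup_{t>0}\Phi(t)m(f/\lambda,t)\le1\}$ (convention $0\cdot\infty=0$). The Hardy-Littlewood maximal operator is $Mf(x)=\sup_{Q}\frac{\chi_Q(x)}{|Q|}\int_Q|f(y)|\,dy$, the supremum being over all cubes $Q\subset\mathbb{R}^n$ with sides parallel to the coordinate axes. *)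

theory Defs
  imports "HOL-Analysis.Analysis"
begin

text \<open>The interval \<open>[0,\<infinity>]\<close> is \<^typ>\<open>ennreal\<close>, where \<open>0 * \<infinity> = 0\<close>, \<open>Inf {} = \<infinity>\<close> and
  \<open>inverse \<infinity> = 0\<close>.\<close>

definition young_a :: "(ennreal \<Rightarrow> ennreal) \<Rightarrow> ennreal" where
  "young_a \<Phi> = Sup {t. \<Phi> t = 0}"

definition young_b :: "(ennreal \<Rightarrow> ennreal) \<Rightarrow> ennreal" where
  "young_b \<Phi> = Inf {t. \<Phi> t = \<infinity>}"

text \<open>\<open>\<Phi>\<close> is finite on \<open>[0, young_b \<Phi>)\<close>, so the conversion to \<^typ>\<open>real\<close> in the convexity
  clause (needed because \<^const>\<open>convex_on\<close> is real-valued) loses nothing.\<close>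

definition young_function :: "(ennreal \<Rightarrow> ennreal) \<Rightarrow> bool" where
  "young_function \<Phi> \<longleftrightarrow>
     mono \<Phi> \<and>
     young_a \<Phi> < \<infinity> \<and> 0 < young_b \<Phi> \<and>
     \<Phi> 0 = 0 \<and> (\<Phi> \<longlongrightarrow> 0) (at_right 0) \<and>
     convex_on {t::real. 0 \<le> t \<and> ennreal t < young_b \<Phi>} (\<lambda>t. enn2real (\<Phi> (ennreal t))) \<and>
     (young_b \<Phi> = \<infinity> \<longrightarrow> \<Phi> \<infinity> = \<infinity> \<and> (\<Phi> \<longlongrightarrow> \<infinity>) (at_left \<infinity>)) \<and>
     (young_b \<Phi> < \<infinity> \<longrightarrow> (\<Phi> \<longlongrightarrow> \<Phi> (young_b \<Phi>)) (at_left (young_b \<Phi>)))"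

definition nabla2 :: "(ennreal \<Rightarrow> ennreal) \<Rightarrow> bool" where
  "nabla2 \<Phi> \<longleftrightarrow>
     (\<exists>k::real. k > 1 \<and>
        (\<forall>r::real. r \<ge> 0 \<longrightarrow> \<Phi> (ennreal r) \<le> ennreal (1 / (2 * k)) * \<Phi> (ennreal (k * r))))"

definition gen_inverse :: "(ennreal \<Rightarrow> ennreal) \<Rightarrow> ennreal \<Rightarrow> ennreal" where
  "gen_inverse \<Phi> u = (if u = \<infinity> then \<infinity> else Inf {t. \<Phi> t > u})"

text \<open>Power with exponent \<open>0 < p < \<infinity>\<close>.\<close>

definition ennpowr :: "ennreal \<Rightarrow> real \<Rightarrow> ennreal" where
  "ennpowr x p = (if x = \<infinity> then \<infinity> else ennreal (enn2real x powr p))"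

text \<open>The distribution function, the rearrangement and the norms depend on a function only through
  its modulus. They are therefore defined on \<open>[0,\<infinity>]\<close>-valued functions and applied to \<open>modulus f\<close>
  for complex-valued \<open>f\<close>, and to the maximal function, which may take the value \<open>\<infinity>\<close>.\<close>

definition modulus :: "('a \<Rightarrow> complex) \<Rightarrow> 'a \<Rightarrow> ennreal" where
  "modulus f x = ennreal (cmod (f x))"

definition distr_fun :: "(real^'n \<Rightarrow> ennreal) \<Rightarrow> real \<Rightarrow> ennreal" where
  "distr_fun g t = emeasure lebesgue {x. g x > ennreal t}"

definition rearrangement :: "(real^'n \<Rightarrow> ennreal) \<Rightarrow> real \<Rightarrow> ennreal" where
  "rearrangement g t = (INF \<alpha>\<in>{\<alpha>::real. \<alpha> > 0 \<and> distr_fun g \<alpha> \<le> ennreal t}. ennreal \<alpha>)"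

definition orlicz_lorentz_norm ::
    "(ennreal \<Rightarrow> ennreal) \<Rightarrow> ennreal \<Rightarrow> (real^'n \<Rightarrow> ennreal) \<Rightarrow> ennreal" where
  "orlicz_lorentz_norm \<Phi> q g =
     (let h = (\<lambda>t::real. inverse (gen_inverse \<Phi> (1 / ennreal t)) * rearrangement g t) in
      if q = \<infinity> then (SUP t\<in>{0<..}. h t)
      else ennpowr (\<integral>\<^sup>+t\<in>{0<..}. ennpowr (h t) (enn2real q) / ennreal t \<partial>lborel)
             (1 / enn2real q))"

definition orlicz_lorentz ::
    "(ennreal \<Rightarrow> ennreal) \<Rightarrow> ennreal \<Rightarrow> (real^'n \<Rightarrow> complex) set" where
  "orlicz_lorentz \<Phi> q =
     {f. f \<in> borel_measurable lebesgue \<and> orlicz_lorentz_norm \<Phi> q (modulus f) < \<infinity>}"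

definition weak_orlicz_sup :: "(ennreal \<Rightarrow> ennreal) \<Rightarrow> (real^'n \<Rightarrow> ennreal) \<Rightarrow> ennreal" where
  "weak_orlicz_sup \<Phi> g = (SUP t\<in>{0::real<..}. \<Phi> (ennreal t) * distr_fun g t)"

definition weak_orlicz_norm :: "(ennreal \<Rightarrow> ennreal) \<Rightarrow> (real^'n \<Rightarrow> ennreal) \<Rightarrow> ennreal" where
  "weak_orlicz_norm \<Phi> g =
     (INF l\<in>{l::real. l > 0 \<and> weak_orlicz_sup \<Phi> (\<lambda>x. g x / ennreal l) \<le> 1}. ennreal l)"

definition weak_orlicz :: "(ennreal \<Rightarrow> ennreal) \<Rightarrow> (real^'n \<Rightarrow> complex) set" where
  "weak_orlicz \<Phi> =
     {f. f \<in> borel_measurable lebesgue \<and>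
         (\<exists>k::real. k > 0 \<and> weak_orlicz_sup \<Phi> (modulus (\<lambda>x. complex_of_real k * f x)) < \<infinity>)}"

definition cubes :: "(real^'n) set set" where
  "cubes = {cbox a (\<chi> i. a $ i + l) | a l. l > 0}"

definition maximal_function :: "(real^'n \<Rightarrow> complex) \<Rightarrow> real^'n \<Rightarrow> ennreal" where
  "maximal_function f x =
     (SUP Q\<in>cubes. indicator Q x / emeasure lebesgue Q * (\<integral>\<^sup>+y\<in>Q. modulus f y \<partial>lebesgue))"

end

theory Submission
  imports Defs
begin

text \<open>Let \<open>w t = 1 / \<Phi>\<^sup>-\<^sup>1(1 / t)\<close>. Splitting \<open>f\<close> at height \<open>f\<^sup>*(t)\<close> and applying the weak type
  \<open>(1,1)\<close> inequality to the upper part, whose integral is estimated on the layers between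
  \<open>f\<^sup>*(t / K\<^sup>j)\<close> and \<open>f\<^sup>*(t / K\<^sup>j\<^sup>+\<^sup>1)\<close>, bounds \<open>(M f)\<^sup>*(t)\<close> by \<open>f\<^sup>*(t)\<close> plus a multiple of
  \<open>\<Sum>\<^sub>j K\<^sup>-\<^sup>j f\<^sup>*(t / K\<^sup>j\<^sup>+\<^sup>1)\<close>. The \<open>\<nabla>\<^sub>2\<close> condition says that \<open>w (K t) \<le> (K / 4) w t\<close> for a
  suitable \<open>K\<close>, so \<open>w (M f)\<^sup>*\<close> at \<open>t\<close> is controlled by a geometrically damped sequence of
  dilates of \<open>w f\<^sup>*\<close>, and the measure \<open>dt / t\<close> is dilation invariant. The weak Orlicz space is the
  case \<open>q = \<infinity>\<close>, up to a constant in the norm.\<close>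

section \<open>Extended nonnegative reals\<close>

text \<open>Multiplication by a positive finite constant is invertible on the extended half-line, so
  such constants can be moved across an inequality even when one side is infinite.\<close>

lemma ennreal_le_cmult_iff:
  fixes a b :: ennreal
  assumes "0 < c"
  shows "a \<le> ennreal c * b \<longleftrightarrow> ennreal (1 / c) * a \<le> b"
proof -
  have "ennreal (1 / c) * ennreal c = 1" "ennreal c * ennreal (1 / c) = 1"
    using assms by (simp_all add: ennreal_mult[symmetric])
  then show ?thesis
    by (metis mult.assoc mult.left_neutral mult_left_mono zero_le)
qed

lemma ennreal_inverse_antimono:
  fixes a b :: ennreal
  assumes "a \<le> b"
  shows "inverse b \<le> inverse a"
  using assms by (cases "a = 0"; cases a; cases b) (auto simp: inverse_ennreal top_unique intro!: ennreal_leI le_imp_inverse_le)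

lemma ennreal_le_suminf:
  fixes x :: "nat \<Rightarrow> ennreal"
  shows "x i \<le> suminf x"
  using sum_le_suminf[of x "{i}"] by simp

lemma ennpowr_mono: "x \<le> y \<Longrightarrow> 0 < p \<Longrightarrow> ennpowr x p \<le> ennpowr y p"
  by (cases x; cases y) (auto simp: ennpowr_def top_unique powr_mono2 intro!: ennreal_leI)

lemma ennpowr_cmult:
  assumes "0 < c"
  shows "ennpowr (ennreal c * x) p = ennreal (c powr p) * ennpowr x p"
  using assms
  by (cases x) (auto simp: ennpowr_def ennreal_mult_top ennreal_mult[symmetric] powr_mult)

lemma ennpowr_ennpowr_inverse: "0 < p \<Longrightarrow> ennpowr (ennpowr x p) (1 / p) = x"
  by (cases x) (auto simp: ennpowr_def powr_powr)

lemma ennpowr_inverse_ennpowr: "0 < p \<Longrightarrow> ennpowr (ennpowr x (1 / p)) p = x"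
  by (cases x) (auto simp: ennpowr_def powr_powr)

lemma measurable_ennpowr [measurable]: "(\<lambda>x. ennpowr x p) \<in> borel_measurable borel"
  unfolding ennpowr_def by measurable

text \<open>Each \<open>x j\<close> is at most the p-th root of the whole sum of p-th powers, hence
  so is the supremum. This replaces a triangle inequality and holds for every p > 0, including p <
  1.\<close>

lemma ennpowr_SUP_le_suminf:
  assumes "0 < p"
  shows "ennpowr (SUP j::nat. x j) p \<le> (\<Sum>j. ennpowr (x j) p)"
proof -
  have "x j \<le> ennpowr (\<Sum>j. ennpowr (x j) p) (1 / p)" for j
  proof -
    have "ennpowr (x j) p \<le> (\<Sum>j. ennpowr (x j) p)"
      by (rule ennreal_le_suminf)
    then show ?thesis
      using ennpowr_mono[of _ _ "1 / p"] ennpowr_ennpowr_inverse[OF assms] assms by fastforce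
  qed
  then have "(SUP j. x j) \<le> ennpowr (\<Sum>j. ennpowr (x j) p) (1 / p)"
    by (rule SUP_least)
  then show ?thesis
    using ennpowr_mono[OF _ assms] ennpowr_inverse_ennpowr[OF assms] by metis
qed

text \<open>Substituting c * t for t produces a Jacobian c that cancels against the factor c in the
  denominator: dt / t is the Haar measure of the multiplicative group of positive reals.\<close>

lemma nn_integral_dilation_invariant:
  fixes F :: "real \<Rightarrow> ennreal"
  assumes [measurable]: "F \<in> borel_measurable borel" and "0 < c"
  shows "(\<integral>\<^sup>+t\<in>{0<..}. F (t / c) / ennreal t \<partial>lborel) = (\<integral>\<^sup>+t\<in>{0<..}. F t / ennreal t \<partial>lborel)"
proof -
  have "(\<integral>\<^sup>+t\<in>{0<..}. F (t / c) / ennreal t \<partial>lborel)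
    = ennreal c * (\<integral>\<^sup>+t. (F (c * t / c) / ennreal (c * t)) * indicator {0<..} (c * t) \<partial>lborel)"
    using nn_integral_real_affine[of "\<lambda>t. F (t / c) / ennreal t * indicator {0<..} t" c 0] assms
    by simp
  also have "\<dots> = (\<integral>\<^sup>+t. ennreal c * ((F (c * t / c) / ennreal (c * t)) * indicator {0<..} (c * t)) \<partial>lborel)"
    by (rule nn_integral_cmult[symmetric]) measurable
  also have "\<dots> = (\<integral>\<^sup>+t\<in>{0<..}. F t / ennreal t \<partial>lborel)"
  proof (rule nn_integral_cong)
    fix t :: real
    show "ennreal c * ((F (c * t / c) / ennreal (c * t)) * indicator {0<..} (c * t))
      = F t / ennreal t * indicator {0<..} t"
    proof (cases "0 < t")
      case True
      have "ennreal c * (F t / (ennreal c * ennreal t)) = F t / ennreal t"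
        using divide_mult_eq[of "ennreal c" "F t" "ennreal t"] \<open>0 < c\<close>
        by (simp add: ennreal_times_divide mult.commute)
      with True \<open>0 < c\<close> show ?thesis
        by (simp add: ennreal_mult)
    next
      case False
      with \<open>0 < c\<close> show ?thesis
        by (simp add: zero_less_mult_iff)
    qed
  qed
  finally show ?thesis .
qed

lemma measurable_antimono_real_ennreal:
  fixes F :: "real \<Rightarrow> ennreal"
  assumes "\<And>s t. s \<le> t \<Longrightarrow> F t \<le> F s"
  shows "F \<in> borel_measurable borel"
proof (rule borel_measurableI_greater)
  fix c
  have "is_interval {t. c < F t}"
    unfolding is_interval_1 using assms by (auto intro: less_le_trans)
  then show "{t \<in> space borel. c < F t} \<in> sets borel"
    by (simp add: real_interval_borel_measurable)
qed

section \<open>The weight\<close>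

definition orlicz_weight :: "(ennreal \<Rightarrow> ennreal) \<Rightarrow> real \<Rightarrow> ennreal" where
  "orlicz_weight \<Phi> t = inverse (gen_inverse \<Phi> (1 / ennreal t))"

lemma gen_inverse_mono: "u \<le> v \<Longrightarrow> gen_inverse \<Phi> u \<le> gen_inverse \<Phi> v"
  by (auto simp: gen_inverse_def top_unique intro!: Inf_superset_mono)

text \<open>Since \<Phi> tends to 0 at 0, it stays below u up to some c > 0, and by monotonicity
  every point where \<Phi> exceeds u is at least c. Consequently the weight is never infinite at
  positive arguments.\<close>

lemma gen_inverse_pos:
  assumes "(\<Phi> \<longlongrightarrow> 0) (at_right 0)" "mono \<Phi>" "0 < u"
  shows "0 < gen_inverse \<Phi> u"
proof (cases "u = \<infinity>")
  case True
  then show ?thesis by (simp add: gen_inverse_def)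
next
  case False
  have "eventually (\<lambda>t. \<Phi> t < u) (at_right 0)"
    using order_tendstoD(2)[OF assms(1,3)] .
  then obtain b where b: "0 < b" "\<And>t. 0 < t \<Longrightarrow> t < b \<Longrightarrow> \<Phi> t < u"
    using eventually_at_right[of 0 "1::ennreal"] by auto
  obtain c where c: "0 < c" "c < b"
    using dense[OF b(1)] by blast
  have "c \<le> t" if "u < \<Phi> t" for t
    using b(2)[OF c] that monoD[OF assms(2), of t c] by force
  with False c have "c \<le> gen_inverse \<Phi> u"
    by (auto simp: gen_inverse_def intro!: Inf_greatest)
  with c show ?thesis by order
qed

text \<open>A finite point where \<Phi> exceeds u exists in both cases: either \<Phi> tends to
  infinity at infinity, or it already takes the value infinity at a finite point.\<close>

lemma gen_inverse_finite:
  assumes "young_function \<Phi>" "u < \<infinity>"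
  shows "gen_inverse \<Phi> u < \<infinity>"
proof -
  have "\<exists>t<\<infinity>. u < \<Phi> t"
  proof (cases "young_b \<Phi> = \<infinity>")
    case True
    then have "(\<Phi> \<longlongrightarrow> \<infinity>) (at_left \<infinity>)"
      using assms by (auto simp: young_function_def)
    then have "eventually (\<lambda>t. u < \<Phi> t) (at_left \<infinity>)"
      using order_tendstoD(1) assms(2) by blast
    then obtain b where b: "b < \<infinity>" "\<And>t. b < t \<Longrightarrow> t < \<infinity> \<Longrightarrow> u < \<Phi> t"
      using eventually_at_left[of 0 "\<infinity>::ennreal"] by auto
    then show ?thesis
      using dense[OF b(1)] by blast
  next
    case False
    then have "Inf {t. \<Phi> t = \<infinity>} < \<infinity>"
      unfolding young_b_def by (simp only: less_top infinity_ennreal_def)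
    then obtain t where "\<Phi> t = \<infinity>" "t < \<infinity>"
      unfolding Inf_less_iff by blast
    then show ?thesis
      using assms(2) by auto
  qed
  then show ?thesis
    using assms(2) unfolding gen_inverse_def by (auto simp: Inf_less_iff)
qed

text \<open>If u < \<Phi>(t), then 2ku < 2k \<Phi>(t) \<le> \<Phi>(kt), so kt is a competitor in the
  infimum defining the inverse at 2ku.\<close>

lemma gen_inverse_nabla2:
  assumes k: "1 < k" and u: "u < \<infinity>"
    and le: "\<And>r::real. 0 \<le> r \<Longrightarrow> \<Phi> (ennreal r) \<le> ennreal (1 / (2 * k)) * \<Phi> (ennreal (k * r))"
  shows "gen_inverse \<Phi> (ennreal (2 * k) * u) \<le> ennreal k * gen_inverse \<Phi> u"
proof -
  have fin: "ennreal (2 * k) * u \<noteq> \<infinity>"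
    using u by (simp add: ennreal_mult_eq_top_iff)
  have step: "gen_inverse \<Phi> (ennreal (2 * k) * u) \<le> ennreal k * t" if t: "u < \<Phi> t" for t
  proof (cases t)
    case (real r)
    have *: "ennreal (2 * k) * ennreal (1 / (2 * k)) = 1"
      using k by (simp add: ennreal_mult[symmetric])
    have "ennreal (2 * k) * u < ennreal (2 * k) * \<Phi> t"
      using t k u by (intro ennreal_mult_strict_left_mono) auto
    also have "\<dots> \<le> ennreal (2 * k) * (ennreal (1 / (2 * k)) * \<Phi> (ennreal (k * r)))"
      using le[of r] real by (intro mult_left_mono) auto
    also have "\<dots> = \<Phi> (ennreal k * t)"
      using k real * by (simp add: mult.assoc[symmetric] ennreal_mult)
    finally show ?thesis
      using fin by (auto simp: gen_inverse_def intro!: Inf_lower)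
  next
    case top
    with k show ?thesis by (simp add: ennreal_mult_top)
  qed
  have "0 < k" using k by simp
  have "ennreal (1 / k) * gen_inverse \<Phi> (ennreal (2 * k) * u) \<le> Inf {t. u < \<Phi> t}"
    by (rule Inf_greatest) (use step ennreal_le_cmult_iff[OF \<open>0 < k\<close>] in auto)
  then show ?thesis
    using u ennreal_le_cmult_iff[OF \<open>0 < k\<close>] by (auto simp: gen_inverse_def)
qed

lemma orlicz_weight_mono: "s \<le> t \<Longrightarrow> orlicz_weight \<Phi> s \<le> orlicz_weight \<Phi> t"
  unfolding orlicz_weight_def divide_ennreal_def
  by (intro ennreal_inverse_antimono gen_inverse_mono mult_left_mono ennreal_leI) auto

text \<open>These bounds make the reciprocal in the weight a genuine positive real, so that it can
  be cleared from inequalities.\<close>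

lemma gen_inverse_reciprocal_bounds:
  assumes "young_function \<Phi>" "0 < t"
  shows "0 < gen_inverse \<Phi> (1 / ennreal t)" "gen_inverse \<Phi> (1 / ennreal t) < \<infinity>"
proof -
  have u: "0 < 1 / ennreal t" "1 / ennreal t < \<infinity>"
    using assms(2) divide_ennreal[of 1 t] by (auto simp: ennreal_zero_less_divide)
  show "0 < gen_inverse \<Phi> (1 / ennreal t)"
    using assms(1) u(1) unfolding young_function_def by (blast intro: gen_inverse_pos)
  show "gen_inverse \<Phi> (1 / ennreal t) < \<infinity>"
    using assms(1) u(2) by (rule gen_inverse_finite)
qed

text \<open>Using the \<open>\<nabla>\<^sub>2\<close> inequality twice, with \<open>K = (2 k)\<^sup>2\<close>, improves the gain from 2 to 4.\<close>

lemma orlicz_weight_growth: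
  assumes "young_function \<Phi>" "nabla2 \<Phi>"
  obtains K :: real where "4 < K"
    "\<And>t. 0 < t \<Longrightarrow> orlicz_weight \<Phi> (K * t) \<le> ennreal (K / 4) * orlicz_weight \<Phi> t"
proof -
  obtain k :: real where k: "1 < k"
    "\<And>r. 0 \<le> r \<Longrightarrow> \<Phi> (ennreal r) \<le> ennreal (1 / (2 * k)) * \<Phi> (ennreal (k * r))"
    using assms(2) unfolding nabla2_def by blast
  have inv: "inverse (ennreal k * x) = ennreal (1 / k) * inverse x" for x
    using k(1) by (subst ennreal_inverse_mult') (auto simp: inverse_ennreal inverse_eq_divide)
  \<comment> \<open>The inverse of \<Phi> is compared at 1/t, which is 2k times 1/(2kt), and at
    1/(2kt); taking reciprocals reverses the inequality.\<close>
  have one: "orlicz_weight \<Phi> (2 * k * t) \<le> ennreal k * orlicz_weight \<Phi> t" if "0 < t" for t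
  proof -
    have "ennreal (2 * k) * (1 / ennreal (2 * k * t)) = 1 / ennreal t"
      using k(1) that by (simp add: divide_ennreal[of 1, simplified] ennreal_mult[symmetric])
    moreover have "1 / ennreal (2 * k * t) < \<infinity>"
      using k(1) that divide_ennreal[of 1 "2 * k * t"] by auto
    ultimately have "gen_inverse \<Phi> (1 / ennreal t) \<le> ennreal k * gen_inverse \<Phi> (1 / ennreal (2 * k * t))"
      using gen_inverse_nabla2[OF k(1) _ k(2), of "1 / ennreal (2 * k * t)"] by simp
    then have "ennreal (1 / k) * orlicz_weight \<Phi> (2 * k * t) \<le> orlicz_weight \<Phi> t"
      using ennreal_inverse_antimono by (fastforce simp: orlicz_weight_def inv)
    then show ?thesis
      using ennreal_le_cmult_iff k(1) by simp
  qed
  have "orlicz_weight \<Phi> (2 * k * (2 * k) * t) \<le> ennreal (2 * k * (2 * k) / 4) * orlicz_weight \<Phi> t"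
    if "0 < t" for t
  proof -
    have "orlicz_weight \<Phi> (2 * k * (2 * k * t)) \<le> ennreal k * orlicz_weight \<Phi> (2 * k * t)"
      using one[of "2 * k * t"] k(1) that by simp
    also have "\<dots> \<le> ennreal k * (ennreal k * orlicz_weight \<Phi> t)"
      using one[OF that] by (intro mult_left_mono) auto
    also have "\<dots> = ennreal (2 * k * (2 * k) / 4) * orlicz_weight \<Phi> t"
      using k(1) by (simp add: ennreal_mult mult.assoc)
    finally show ?thesis by (simp add: mult.assoc)
  qed
  moreover have "4 < 2 * k * (2 * k)"
    using mult_strict_mono[of 1 k 1 k] k(1) by simp
  ultimately show ?thesis
    using that by blast
qed

section \<open>The maximal function\<close>

abbreviation cube :: "real^'n \<Rightarrow> real \<Rightarrow> (real^'n) set" where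
  "cube a l \<equiv> cbox a (\<chi> i. a $ i + l)"

lemma emeasure_cube:
  fixes a :: "real^'n"
  assumes "0 \<le> l"
  shows "emeasure lborel (cube a l) = ennreal (l ^ CARD('n))"
proof -
  have "cube a l \<noteq> {}"
    using assms by (auto simp: interval_ne_empty_cart)
  then have "measure lborel (cube a l) = l ^ CARD('n)"
    by (simp add: content_cbox_cart)
  moreover have "emeasure lborel (cube a l) = ennreal (measure lborel (cube a l))"
    using emeasure_lborel_cbox_finite[of a "\<chi> i. a $ i + l"]
    by (subst emeasure_eq_ennreal_measure[symmetric]) auto
  ultimately show ?thesis by simp
qed

text \<open>The Euclidean norm is at most the sum of the coordinates in modulus. The radius n * l is
  cruder than the diameter of the cube but gives a simple explicit constant.\<close>

lemma cube_subset_cball: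
  fixes a :: "real^'n"
  shows "cube a l \<subseteq> cball a (real CARD('n) * l)"
proof
  fix x assume "x \<in> cube a l"
  then have "\<bar>(a - x) $ i\<bar> \<le> l" for i
    by (auto simp: mem_box_cart abs_le_iff algebra_simps)
  then have "(\<Sum>i\<in>UNIV. \<bar>(a - x) $ i\<bar>) \<le> real CARD('n) * l"
    using sum_bounded_above[of UNIV "\<lambda>i. \<bar>(a - x) $ i\<bar>" l] by simp
  then show "x \<in> cball a (real CARD('n) * l)"
    using norm_le_l1_cart[of "a - x"] by (simp add: dist_norm)
qed

lemma cball_subset_cube:
  fixes a :: "real^'n"
  shows "cball a r \<subseteq> cube (a - (\<chi> i. r)) (2 * r)"
proof
  fix x assume "x \<in> cball a r"
  then have "\<bar>(a - x) $ i\<bar> \<le> r" for i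
    using component_le_norm_cart[of "a - x" i] by (simp add: dist_norm)
  then have "a $ i - r \<le> x $ i \<and> x $ i \<le> a $ i + r" for i
    by (simp add: abs_le_iff algebra_simps)
  then show "x \<in> cube (a - (\<chi> i. r)) (2 * r)"
    by (simp add: mem_box_cart add.commute)
qed

section \<open>Superlevel sets and measurability of the maximal function\<close>

lemma measurable_modulus [measurable]:
  "f \<in> borel_measurable M \<Longrightarrow> modulus f \<in> borel_measurable M"
  unfolding modulus_def by measurable

text \<open>Cubes have positive finite measure, so the division in an average can be cleared. Later
  arguments use this form and never handle the supremum over cubes directly.\<close>

lemma maximal_function_gt_iff:
  fixes f :: "real^'n \<Rightarrow> complex"
  shows "c < maximal_function f x \<longleftrightarrow>
    (\<exists>a l. 0 < l \<and> x \<in> cube a l \<and>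
       c * ennreal (l ^ CARD('n)) < (\<integral>\<^sup>+y\<in>cube a l. modulus f y \<partial>lebesgue))"
proof -
  have *: "c < indicator (cube a l) x / emeasure lebesgue (cube a l) * I
      \<longleftrightarrow> x \<in> cube a l \<and> c * ennreal (l ^ CARD('n)) < I" if "0 < l" for a l and I :: ennreal
  proof (cases "x \<in> cube a l")
    case True
    have "c < ennreal (1 / l ^ CARD('n)) * I \<longleftrightarrow> c * ennreal (l ^ CARD('n)) < I"
      using ennreal_le_cmult_iff[of "l ^ CARD('n)" I c] that zero_less_power[OF that, of "CARD('n)"]
      by (simp add: mult.commute[of c] not_le[symmetric] del: zero_less_power)
    with True that show ?thesis
      using divide_ennreal[of 1 "l ^ CARD('n)"] by (simp add: emeasure_cube)
  qed simp
  have "c < maximal_function f x \<longleftrightarrow> (\<exists>Q\<in>cubes. c < indicator Q x / emeasure lebesgue Q * (\<integral>\<^sup>+y\<in>Q. modulus f y \<partial>lebesgue))"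
    unfolding maximal_function_def less_SUP_iff ..
  also have "\<dots> \<longleftrightarrow> (\<exists>a l. 0 < l \<and>
      c < indicator (cube a l) x / emeasure lebesgue (cube a l) * (\<integral>\<^sup>+y\<in>cube a l. modulus f y \<partial>lebesgue))"
    unfolding cubes_def by blast
  finally show ?thesis
    using * by blast
qed

text \<open>The strict inequality for a cube containing x survives a slight enlargement of the cube,
  and the interior of the enlarged cube is a neighbourhood of x on which the same cube is a
  witness.\<close>

lemma open_maximal_function_gt:
  fixes f :: "real^'n \<Rightarrow> complex"
  shows "open {x. c < maximal_function f x}"
proof (subst open_subopen, intro ballI)
  fix x assume "x \<in> {x. c < maximal_function f x}"
  then obtain a l where l: "0 < l" and x: "x \<in> cube a l"
    and less: "c * ennreal (l ^ CARD('n)) < (\<integral>\<^sup>+y\<in>cube a l. modulus f y \<partial>lebesgue)"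
    by (auto simp: maximal_function_gt_iff)
  have "c \<noteq> top"
    using less l by (auto simp: ennreal_top_mult)
  then obtain d where d: "0 \<le> d" "c = ennreal d"
    by (cases c) auto
  have eq: "c * ennreal (s ^ CARD('n)) = ennreal (d * s ^ CARD('n))" if "0 \<le> s" for s
    using d that by (simp add: ennreal_mult)
  \<comment> \<open>Continuity of the volume in the side length leaves room for adding some \<delta>
    > 0 on each side of the cube.\<close>
  have "((\<lambda>\<delta>. ennreal (d * (l + 2 * \<delta>) ^ CARD('n))) \<longlongrightarrow> ennreal (d * (l + 2 * 0) ^ CARD('n))) (at_right 0)"
    by (intro tendsto_intros)
  then have "eventually (\<lambda>\<delta>. ennreal (d * (l + 2 * \<delta>) ^ CARD('n)) < (\<integral>\<^sup>+y\<in>cube a l. modulus f y \<partial>lebesgue)) (at_right 0)"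
    using less eq[of l] l by (auto intro: order_tendstoD)
  then obtain b :: real where b: "0 < b"
    "\<And>\<delta>. 0 < \<delta> \<Longrightarrow> \<delta> < b \<Longrightarrow> ennreal (d * (l + 2 * \<delta>) ^ CARD('n)) < (\<integral>\<^sup>+y\<in>cube a l. modulus f y \<partial>lebesgue)"
    using eventually_at_right[of 0 "1::real"] by auto
  define \<delta> where "\<delta> = b / 2"
  define a' :: "real^'n" where "a' = a - (\<chi> i. \<delta>)"
  have \<delta>: "0 < \<delta>" "\<delta> < b"
    using b(1) by (auto simp: \<delta>_def)
  have sub: "cube a l \<subseteq> box a' (\<chi> i. a' $ i + (l + 2 * \<delta>))"
    using \<delta>(1) by (auto simp: mem_box_cart a'_def) (smt (verit))+
  have "c * ennreal ((l + 2 * \<delta>) ^ CARD('n)) < (\<integral>\<^sup>+y\<in>cube a l. modulus f y \<partial>lebesgue)"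
    using b(2)[OF \<delta>] eq[of "l + 2 * \<delta>"] l \<delta> by simp
  also have "\<dots> \<le> (\<integral>\<^sup>+y\<in>cube a' (l + 2 * \<delta>). modulus f y \<partial>lebesgue)"
    using sub box_subset_cbox by (intro nn_integral_mono) (fastforce simp: indicator_def)
  finally have "c < maximal_function f z" if "z \<in> cube a' (l + 2 * \<delta>)" for z
    using that l \<delta> by (subst maximal_function_gt_iff) (intro exI[of _ a'] exI[of _ "l + 2 * \<delta>"], auto)
  then show "\<exists>T. open T \<and> x \<in> T \<and> T \<subseteq> {x. c < maximal_function f x}"
    using sub x box_subset_cbox by (intro exI[of _ "box a' (\<chi> i. a' $ i + (l + 2 * \<delta>))"]) blast
qed

lemma measurable_maximal_function [measurable]:
  fixes f :: "real^'n \<Rightarrow> complex"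
  shows "maximal_function f \<in> borel_measurable lebesgue"
proof (rule borel_measurableI_greater)
  fix c
  have "{x. c < maximal_function f x} \<in> sets lebesgue"
    using borel_open[OF open_maximal_function_gt[of c f]] by auto
  then show "{x \<in> space lebesgue. c < maximal_function f x} \<in> sets lebesgue"
    by simp
qed

section \<open>The weak type (1,1) inequality\<close>

text \<open>Countable subadditivity for an arbitrary countable index set, as supplied by the Vitali
  lemma. The sum is an integral over \<open>count_space C\<close>, which matches the form of
  additivity over disjoint unions used for the cubes.\<close>

lemma emeasure_countable_Union_le:
  assumes "countable C" "\<And>i. i \<in> C \<Longrightarrow> X i \<in> sets M"
  shows "emeasure M (\<Union>i\<in>C. X i) \<le> (\<integral>\<^sup>+i. emeasure M (X i) \<partial>count_space C)"
proof -
  have "(\<Union>i\<in>C. X i) \<in> sets M"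
    using assms by (rule sets.countable_UN'')
  then have "emeasure M (\<Union>i\<in>C. X i) = (\<integral>\<^sup>+x. indicator (\<Union>i\<in>C. X i) x \<partial>M)"
    by simp
  also have "\<dots> \<le> (\<integral>\<^sup>+x. (\<integral>\<^sup>+i. indicator (X i) x \<partial>count_space C) \<partial>M)"
  proof (rule nn_integral_mono)
    fix x
    show "indicator (\<Union>i\<in>C. X i) x \<le> (\<integral>\<^sup>+i. indicator (X i) x \<partial>count_space C)"
    proof (cases "x \<in> (\<Union>i\<in>C. X i)")
      case True
      then obtain i where i: "i \<in> C" "x \<in> X i" by blast
      have "1 = (\<integral>\<^sup>+j. indicator {i} j \<partial>count_space C)"
        using i by simp
      also have "\<dots> \<le> (\<integral>\<^sup>+i. indicator (X i) x \<partial>count_space C)"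
        using i by (intro nn_integral_mono) (auto simp: indicator_def)
      finally show ?thesis
        using True by simp
    qed simp
  qed
  also have "\<dots> = (\<integral>\<^sup>+i. emeasure M (X i) \<partial>count_space C)"
    using assms by (subst nn_integral_count_space_nn_integral) (auto intro!: nn_integral_cong)
  finally show ?thesis .
qed

text \<open>The superlevel set is covered by cubes with average above \<alpha>. The Vitali lemma,
  applied to balls around these cubes, selects countably many disjoint balls whose fivefold dilates
  still cover. Each dilate has measure at most a constant times that of its cube, and the integrals
  over the disjoint cubes add up to at most the whole integral.\<close>

lemma maximal_function_weak_type:
  fixes f :: "real^'n \<Rightarrow> complex"
  assumes [measurable]: "f \<in> borel_measurable lebesgue" and \<alpha>: "0 < \<alpha>"
  shows "ennreal \<alpha> * distr_fun (maximal_function f) \<alpha>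
    \<le> ennreal ((10 * real CARD('n)) ^ CARD('n)) * (\<integral>\<^sup>+y. modulus f y \<partial>lebesgue)"
proof (cases "(\<integral>\<^sup>+y. modulus f y \<partial>lebesgue) = top")
  case True
  then show ?thesis by (simp add: ennreal_mult_top)
next
  case False
  let ?n = "CARD('n)"
  have [measurable]: "modulus f \<in> borel_measurable lebesgue"
    by measurable
  define I where "I = enn2real (\<integral>\<^sup>+y. modulus f y \<partial>lebesgue)"
  have I: "(\<integral>\<^sup>+y. modulus f y \<partial>lebesgue) = ennreal I"
    using False by (simp add: I_def less_top)
  have Qle: "(\<integral>\<^sup>+y\<in>Q. modulus f y \<partial>lebesgue) \<le> ennreal I" for Q
    unfolding I[symmetric] by (intro nn_integral_mono) (auto simp: indicator_def)
  define S where "S = {x. ennreal \<alpha> < maximal_function f x}"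
  define K :: "((real^'n) \<times> real) set" where
    "K = {(a, l). 0 < l \<and> ennreal \<alpha> * ennreal (l ^ ?n) < (\<integral>\<^sup>+y\<in>cube a l. modulus f y \<partial>lebesgue)}"
  define r :: "(real^'n) \<times> real \<Rightarrow> real" where "r = (\<lambda>(a, l). real ?n * l)"
  define Q :: "(real^'n) \<times> real \<Rightarrow> (real^'n) set" where "Q = (\<lambda>(a, l). cube a l)"
  have Qsub: "Q p \<subseteq> cball (fst p) (r p)" for p
    using cube_subset_cball by (auto simp: Q_def r_def split: prod.split)
  have "S \<subseteq> (\<Union>p\<in>K. Q p)"
    by (auto simp: S_def K_def Q_def maximal_function_gt_iff)
  then have cover: "S \<subseteq> (\<Union>p\<in>K. cball (fst p) (r p))"
    using Qsub by blast
  \<comment> \<open>The covering lemma needs bounded radii. A cube in \<open>K\<close> satisfies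
    \<alpha> * l^n < I with I finite, and l \<le> l^n as soon as l \<ge> 1.\<close>
  have bound: "0 < r p \<and> r p \<le> real ?n * max 1 (I / \<alpha>)" if "p \<in> K" for p
  proof -
    obtain a l where p: "p = (a, l)" by (cases p)
    then have l: "0 < l" and "ennreal \<alpha> * ennreal (l ^ ?n) < ennreal I"
      using that Qle[of "cube a l"] by (auto simp: K_def intro: order.strict_trans2)
    then have "\<alpha> * l ^ ?n < I"
      using \<alpha> by (simp add: ennreal_mult[symmetric] ennreal_less_iff)
    then have "l ^ ?n \<le> I / \<alpha>"
      using \<alpha> by (simp add: field_simps)
    moreover have "l \<le> l ^ ?n" if "1 \<le> l"
      using that by (simp add: self_le_power)
    ultimately have "l \<le> max 1 (I / \<alpha>)" by linarith
    then show ?thesis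
      using l by (simp add: p r_def)
  qed
  obtain C where C: "countable C" "C \<subseteq> K"
    and disj: "pairwise (\<lambda>i j. disjnt (cball (fst i) (r i)) (cball (fst j) (r j))) C"
    and SC: "S \<subseteq> (\<Union>i\<in>C. cball (fst i) (5 * r i))"
    using Vitali_covering_lemma_cballs[OF cover bound] by blast
  \<comment> \<open>The cubes inherit disjointness from the balls that contain them.\<close>
  have disjQ: "disjoint_family_on Q C"
    using disj Qsub unfolding disjoint_family_on_def pairwise_def disjnt_def by blast
  \<comment> \<open>The dilated ball has radius 5nl, hence lies in a cube of side 10nl and volume
    (10n)^n * l^n; this is the origin of the constant.\<close>
  have each: "ennreal \<alpha> * emeasure lebesgue (cball (fst p) (5 * r p))
      \<le> ennreal ((10 * real ?n) ^ ?n) * emeasure (density lebesgue (modulus f)) (Q p)" if "p \<in> C" for p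
  proof -
    obtain a l where p: "p = (a, l)" by (cases p)
    have l: "0 < l" and less: "ennreal \<alpha> * ennreal (l ^ ?n) < (\<integral>\<^sup>+y\<in>cube a l. modulus f y \<partial>lebesgue)"
      using that C(2) p by (auto simp: K_def)
    have "emeasure lebesgue (cball a (5 * r p)) \<le> emeasure lebesgue (cube (a - (\<chi> i. 5 * r p)) (2 * (5 * r p)))"
      by (intro emeasure_mono cball_subset_cube) auto
    also have "\<dots> = ennreal ((10 * real ?n) ^ ?n) * ennreal (l ^ ?n)"
    proof -
      have "2 * (5 * r p) = 10 * real ?n * l" by (simp add: r_def p)
      then show ?thesis
        using l emeasure_cube[of "2 * (5 * r p)" "a - (\<chi> i. 5 * r p)"]
        by (simp add: power_mult_distrib ennreal_mult mult.assoc)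
    qed
    finally have "ennreal \<alpha> * emeasure lebesgue (cball a (5 * r p))
        \<le> ennreal ((10 * real ?n) ^ ?n) * (ennreal \<alpha> * ennreal (l ^ ?n))"
      by (metis mult.left_commute mult_left_mono zero_le)
    also have "\<dots> \<le> ennreal ((10 * real ?n) ^ ?n) * (\<integral>\<^sup>+y\<in>cube a l. modulus f y \<partial>lebesgue)"
      using less by (intro mult_left_mono) auto
    also have "(\<integral>\<^sup>+y\<in>cube a l. modulus f y \<partial>lebesgue) = emeasure (density lebesgue (modulus f)) (Q p)"
      by (subst emeasure_density) (auto simp: Q_def p)
    finally show ?thesis by (simp add: p)
  qed
  have "ennreal \<alpha> * emeasure lebesgue S \<le> ennreal \<alpha> * emeasure lebesgue (\<Union>i\<in>C. cball (fst i) (5 * r i))"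
    by (intro mult_left_mono emeasure_mono SC sets.countable_UN'' C) auto
  also have "\<dots> \<le> ennreal \<alpha> * (\<integral>\<^sup>+p. emeasure lebesgue (cball (fst p) (5 * r p)) \<partial>count_space C)"
    by (intro mult_left_mono emeasure_countable_Union_le C) auto
  also have "\<dots> = (\<integral>\<^sup>+p. ennreal \<alpha> * emeasure lebesgue (cball (fst p) (5 * r p)) \<partial>count_space C)"
    by (simp add: nn_integral_cmult)
  also have "\<dots> \<le> (\<integral>\<^sup>+p. ennreal ((10 * real ?n) ^ ?n) * emeasure (density lebesgue (modulus f)) (Q p) \<partial>count_space C)"
    by (intro nn_integral_mono each) simp
  also have "\<dots> = ennreal ((10 * real ?n) ^ ?n) * emeasure (density lebesgue (modulus f)) (\<Union>p\<in>C. Q p)"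
    using disjQ C(1) by (subst emeasure_UN_countable) (auto simp: nn_integral_cmult Q_def)
  also have "emeasure (density lebesgue (modulus f)) (\<Union>p\<in>C. Q p) \<le> emeasure (density lebesgue (modulus f)) UNIV"
    using emeasure_space[of "density lebesgue (modulus f)"] by simp
  also have "emeasure (density lebesgue (modulus f)) UNIV = (\<integral>\<^sup>+y. modulus f y \<partial>lebesgue)"
    by (subst emeasure_density) auto
  finally show ?thesis
    by (simp add: S_def distr_fun_def mult_left_mono)
qed

text \<open>Averaging is monotone and additive, and the average of the constant c over a cube is
  c.\<close>

lemma maximal_function_le_add:
  fixes f g :: "real^'n \<Rightarrow> complex"
  assumes [measurable]: "g \<in> borel_measurable lebesgue"
    and "\<And>y. modulus f y \<le> c + modulus g y"
  shows "maximal_function f x \<le> c + maximal_function g x"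
proof (rule ccontr)
  assume "\<not> ?thesis"
  then obtain a l where l: "0 < l" and x: "x \<in> cube a l"
    and less: "(c + maximal_function g x) * ennreal (l ^ CARD('n)) < (\<integral>\<^sup>+y\<in>cube a l. modulus f y \<partial>lebesgue)"
    by (auto simp: not_le maximal_function_gt_iff)
  have [measurable]: "modulus g \<in> borel_measurable lebesgue"
    by measurable
  have "(\<integral>\<^sup>+y\<in>cube a l. modulus f y \<partial>lebesgue)
      \<le> (\<integral>\<^sup>+y. c * indicator (cube a l) y + modulus g y * indicator (cube a l) y \<partial>lebesgue)"
    using assms(2) by (intro nn_integral_mono) (auto simp: indicator_def)
  also have "\<dots> = c * ennreal (l ^ CARD('n)) + (\<integral>\<^sup>+y\<in>cube a l. modulus g y \<partial>lebesgue)"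
    using l by (subst nn_integral_add)
      (auto simp: nn_integral_cmult_indicator emeasure_cube intro!: borel_measurable_times_ennreal borel_measurable_indicator)
  also have "\<dots> \<le> (c + maximal_function g x) * ennreal (l ^ CARD('n))"
  proof -
    \<comment> \<open>Taking the value at x itself as the level, the negated superlevel
      characterization bounds the integral of g over every cube containing x.\<close>
    have "\<not> maximal_function g x < maximal_function g x" by simp
    then have "(\<integral>\<^sup>+y\<in>cube a l. modulus g y \<partial>lebesgue) \<le> maximal_function g x * ennreal (l ^ CARD('n))"
      using l x unfolding maximal_function_gt_iff[of "maximal_function g x" g x] by (meson not_less)
    then show ?thesis by (simp add: distrib_right add_left_mono)
  qed
  finally show False
    using less by simp
qed

section \<open>The decreasing rearrangement\<close>

lemma rearrangement_antimono: "s \<le> t \<Longrightarrow> rearrangement g t \<le> rearrangement g s"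
  unfolding rearrangement_def
  by (intro INF_superset_mono) (auto intro: order_trans ennreal_leI)

lemma rearrangement_le: "0 < \<alpha> \<Longrightarrow> distr_fun g \<alpha> \<le> ennreal t \<Longrightarrow> rearrangement g t \<le> ennreal \<alpha>"
  unfolding rearrangement_def by (intro INF_lower) simp

text \<open>The infimum defining the rearrangement need not be a minimum over positive levels. The
  set is therefore exhausted by superlevel sets slightly above the infimum, each of measure at most
  t because an admissible level lies below, and continuity from below gives the limit.\<close>

lemma emeasure_gt_rearrangement_le:
  fixes g :: "real^'n \<Rightarrow> ennreal"
  assumes [measurable]: "g \<in> borel_measurable lebesgue"
  shows "emeasure lebesgue {x. rearrangement g t < g x} \<le> ennreal t"
proof (cases "rearrangement g t")
  case (real d)
  define A where "A m = {x. ennreal (d + 1 / Suc m) < g x}" for m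
  have [measurable]: "A m \<in> sets lebesgue" for m
  proof -
    have "{x \<in> space lebesgue. ennreal (d + 1 / Suc m) < g x} \<in> sets lebesgue" by measurable
    then show ?thesis by (simp add: A_def)
  qed
  have le: "emeasure lebesgue (A m) \<le> ennreal t" for m
  proof -
    have "rearrangement g t < ennreal (d + 1 / Suc m)"
      using real by (simp add: ennreal_less_iff)
    then obtain \<alpha> where \<alpha>: "distr_fun g \<alpha> \<le> ennreal t" "ennreal \<alpha> < ennreal (d + 1 / Suc m)"
      unfolding rearrangement_def by (auto simp: INF_less_iff)
    have "{x. ennreal \<alpha> < g x} \<in> sets lebesgue"
      using borel_measurable_less[of "\<lambda>_. ennreal \<alpha>" lebesgue g] by simp
    then have "emeasure lebesgue (A m) \<le> distr_fun g \<alpha>"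
      unfolding distr_fun_def using \<alpha>(2) by (intro emeasure_mono) (auto simp: A_def intro: less_trans)
    with \<alpha>(1) show ?thesis by order
  qed
  have "incseq A"
  proof (rule incseq_SucI, rule subsetI)
    fix m x assume "x \<in> A m"
    moreover have "ennreal (d + 1 / Suc (Suc m)) \<le> ennreal (d + 1 / Suc m)"
      by (intro ennreal_leI add_left_mono divide_left_mono) auto
    ultimately show "x \<in> A (Suc m)"
      unfolding A_def using le_less_trans by blast
  qed
  moreover have "{x. rearrangement g t < g x} = (\<Union>m. A m)"
  proof safe
    fix x assume x: "rearrangement g t < g x"
    have "(\<lambda>m. ennreal (d + 1 / Suc m)) \<longlonglongrightarrow> ennreal (d + 0)"
      by (intro tendsto_ennrealI tendsto_add tendsto_const LIMSEQ_inverse_real_of_nat[unfolded inverse_eq_divide])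
    then have "eventually (\<lambda>m. ennreal (d + 1 / Suc m) < g x) sequentially"
      using x real by (auto intro: order_tendstoD)
    then show "x \<in> (\<Union>m. A m)"
      by (auto simp: A_def eventually_sequentially)
  next
    fix m x assume "x \<in> A m"
    moreover have "ennreal d \<le> ennreal (d + 1 / Suc m)"
      by (intro ennreal_leI) simp
    ultimately have "ennreal d < g x"
      unfolding A_def using le_less_trans by blast
    then show "rearrangement g t < g x"
      using real(2) by simp
  qed
  ultimately have "emeasure lebesgue {x. rearrangement g t < g x} = (SUP m. emeasure lebesgue (A m))"
    using SUP_emeasure_incseq[of A lebesgue] \<open>\<And>m. A m \<in> sets lebesgue\<close> by (simp add: image_subset_iff)
  also have "\<dots> \<le> ennreal t"
    by (rule SUP_least) (rule le)
  finally show ?thesis .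
qed simp

section \<open>Rearrangement estimate for the maximal function\<close>

text \<open>The set where g exceeds its rearrangement at t / K^j has measure at most t / K^j, and on
  the layer between this set and the next one g is at most its rearrangement at t / K^(j+1).\<close>

lemma nn_integral_truncation_le:
  fixes g :: "real^'n \<Rightarrow> ennreal" and K :: real
  assumes [measurable]: "g \<in> borel_measurable lebesgue" and "0 < t" "1 < K"
  shows "(\<integral>\<^sup>+y\<in>{y. rearrangement g t < g y}. g y \<partial>lebesgue)
    \<le> (\<Sum>j. rearrangement g (t / K ^ Suc j) * ennreal (t / K ^ j))"
proof -
  define L where "L j = rearrangement g (t / K ^ j)" for j
  define A where "A j = {y. L j < g y}" for j
  have [measurable]: "A j \<in> sets lebesgue" for j
  proof -
    have "{x \<in> space lebesgue. L j < g x} \<in> sets lebesgue" by measurable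
    then show ?thesis by (simp add: A_def)
  qed
  have mA: "emeasure lebesgue (A j) \<le> ennreal (t / K ^ j)" for j
    unfolding A_def L_def by (rule emeasure_gt_rearrangement_le) fact
  \<comment> \<open>Points above all levels belong to no layer; they are negligible because t / K^j
    tends to 0.\<close>
  have "emeasure lebesgue (\<Inter>j. A j) \<le> 0"
  proof (rule tendsto_lowerbound)
    have "(\<lambda>j. t * (1 / K) ^ j) \<longlonglongrightarrow> t * 0"
      using assms(3) by (intro tendsto_mult tendsto_const LIMSEQ_power_zero) auto
    then have "(\<lambda>j. ennreal (t / K ^ j)) \<longlonglongrightarrow> ennreal 0"
      by (intro tendsto_ennrealI) (simp add: power_one_over)
    then show "(\<lambda>j. ennreal (t / K ^ j)) \<longlonglongrightarrow> 0"
      by simp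
    show "\<forall>\<^sub>F j in sequentially. emeasure lebesgue (\<Inter>j. A j) \<le> ennreal (t / K ^ j)"
      using mA by (intro always_eventually allI order_trans[OF emeasure_mono mA]) auto
  qed simp
  then have null: "(\<Inter>j. A j) \<in> null_sets lebesgue"
    by (intro null_setsI) auto
  have "AE y in lebesgue. g y * indicator {y. rearrangement g t < g y} y
      \<le> (\<Sum>j. L (Suc j) * indicator (A j) y)"
    using AE_not_in[OF null]
  proof eventually_elim
    case (elim y)
    show ?case
    proof (cases "y \<in> A 0")
      case True
      \<comment> \<open>The first level not exceeded at y. It is positive because y lies in
        \<open>A 0\<close>, so y belongs to the layer with index J - 1.\<close>
      define J where "J = (LEAST j. y \<notin> A j)"
      have "\<exists>j. y \<notin> A j"
        using elim by blast
      then have J: "y \<notin> A J" "\<And>j. j < J \<Longrightarrow> y \<in> A j"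
        unfolding J_def by (rule LeastI_ex) (use not_less_Least in blast)
      then obtain i where i: "J = Suc i"
        using True by (cases J) auto
      have "g y \<le> L (Suc i) * indicator (A i) y"
        using J i by (simp add: A_def not_less)
      also have "\<dots> \<le> (\<Sum>j. L (Suc j) * indicator (A j) y)"
        by (rule ennreal_le_suminf)
      finally show ?thesis
        using True by (simp add: A_def L_def)
    next
      case False
      then show ?thesis by (simp add: A_def L_def)
    qed
  qed
  then have "(\<integral>\<^sup>+y\<in>{y. rearrangement g t < g y}. g y \<partial>lebesgue)
      \<le> (\<integral>\<^sup>+y. (\<Sum>j. L (Suc j) * indicator (A j) y) \<partial>lebesgue)"
    by (rule nn_integral_mono_AE)
  also have "\<dots> = (\<Sum>j. L (Suc j) * emeasure lebesgue (A j))"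
    by (subst nn_integral_suminf) (simp_all add: nn_integral_cmult_indicator)
  also have "\<dots> \<le> (\<Sum>j. L (Suc j) * ennreal (t / K ^ j))"
    by (intro suminf_le mult_left_mono mA) auto
  finally show ?thesis by (simp add: L_def)
qed

lemma rearrangement_maximal_function_le:
  fixes f :: "real^'n \<Rightarrow> complex" and K :: real
  assumes [measurable]: "f \<in> borel_measurable lebesgue" and t: "0 < t" and K: "1 < K"
  shows "rearrangement (maximal_function f) t
    \<le> rearrangement (modulus f) t + ennreal ((10 * real CARD('n)) ^ CARD('n)) *
        (\<Sum>j. ennreal (1 / K ^ j) * rearrangement (modulus f) (t / K ^ Suc j))"
    (is "_ \<le> ?v + ennreal ?D * ?S")
proof (cases "?v = top \<or> ?S = top")
  case True
  \<comment> \<open>The constant is positive, so an infinite term on the right makes the whole bound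
    infinite.\<close>
  have "ennreal ?D * top = top"
    by (simp add: ennreal_mult_top)
  with True show ?thesis by auto
next
  case False
  define L where "L = enn2real ?v"
  define S where "S = enn2real ?S"
  have L: "?v = ennreal L" "0 \<le> L" and S: "?S = ennreal S" "0 \<le> S"
    using False by (auto simp: L_def S_def less_top)
  \<comment> \<open>The upper part of f: discarding the values of modulus at most \<open>?v\<close>
    lowers the modulus by at most \<open>?v\<close>, while the integral of the remainder is
    controlled by the layer estimate.\<close>
  define g where "g y = (if ?v < modulus f y then f y else 0)" for y
  have [measurable]: "g \<in> borel_measurable lebesgue"
    unfolding g_def by measurable
  have "(\<integral>\<^sup>+y. modulus g y \<partial>lebesgue) = (\<integral>\<^sup>+y\<in>{y. ?v < modulus f y}. modulus f y \<partial>lebesgue)"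
    by (intro nn_integral_cong) (auto simp: g_def modulus_def)
  also have "\<dots> \<le> (\<Sum>j. rearrangement (modulus f) (t / K ^ Suc j) * ennreal (t / K ^ j))"
    by (intro nn_integral_truncation_le t K) measurable
  also have "\<dots> = (\<Sum>j. ennreal t * (ennreal (1 / K ^ j) * rearrangement (modulus f) (t / K ^ Suc j)))"
    using t K by (intro suminf_cong) (simp add: mult.assoc[symmetric] ennreal_mult[symmetric] mult.commute)
  also have "\<dots> = ennreal (t * S)"
    using t S by (simp add: ennreal_suminf_cmult ennreal_mult)
  finally have intg: "(\<integral>\<^sup>+y. modulus g y \<partial>lebesgue) \<le> ennreal (t * S)" .
  have D: "0 < ?D" by simp
  have eps: "rearrangement (maximal_function f) t \<le> (?v + ennreal ?D * ?S) + ennreal e" if e: "0 < e" for e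
  proof -
    \<comment> \<open>The summand e keeps \<beta> positive when S = 0, as the weak type inequality
      requires. Since \<beta> \<ge> D * S, that inequality at height \<beta> gives a superlevel set
      of measure at most D * t * S / \<beta> \<le> t.\<close>
    define \<beta> where "\<beta> = ?D * S + e"
    have \<beta>: "0 < \<beta>"
      using S e unfolding \<beta>_def by (intro add_nonneg_pos) auto
    have "maximal_function f x \<le> ennreal L + maximal_function g x" for x
      by (rule maximal_function_le_add) (auto simp: g_def L modulus_def not_less)
    then have "{x. ennreal (L + \<beta>) < maximal_function f x} \<subseteq> {x. ennreal \<beta> < maximal_function g x}"
      using L(2) \<beta> by (auto simp: ennreal_plus not_less[symmetric]) (meson add_left_mono le_less_trans not_le order_trans)
    then have "distr_fun (maximal_function f) (L + \<beta>) \<le> distr_fun (maximal_function g) \<beta>"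
      unfolding distr_fun_def
      by (intro emeasure_mono) (use borel_measurable_less[of "\<lambda>_. ennreal \<beta>" lebesgue "maximal_function g"] in auto)
    also have "\<dots> \<le> ennreal t"
    proof -
      have "ennreal \<beta> * distr_fun (maximal_function g) \<beta> \<le> ennreal ?D * ennreal (t * S)"
        using maximal_function_weak_type[OF _ \<beta>, of g] mult_left_mono[OF intg] by (force intro: order_trans)
      also have "\<dots> \<le> ennreal \<beta> * ennreal t"
        using S t e \<beta> unfolding ennreal_mult[symmetric, of \<beta> t, OF less_imp_le less_imp_le, OF \<beta> t]
        by (subst ennreal_mult[symmetric]) (auto simp: \<beta>_def algebra_simps intro!: ennreal_leI)
      finally show ?thesis
        using \<beta> by (simp add: ennreal_mult_le_mult_iff)
    qed
    finally have "rearrangement (maximal_function f) t \<le> ennreal (L + \<beta>)"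
      using L \<beta> by (intro rearrangement_le) auto
    also have "\<dots> = (?v + ennreal ?D * ?S) + ennreal e"
      using L S e D by (simp add: \<beta>_def ennreal_plus ennreal_mult add.assoc)
    finally show ?thesis .
  qed
  show ?thesis
    by (rule ennreal_le_epsilon) (rule eps)
qed

section \<open>The Orlicz--Lorentz quasi-norm\<close>

text \<open>The function whose quasi-norm with respect to dt / t, or supremum for infinite q, is the
  Orlicz-Lorentz quasi-norm.\<close>

definition weighted_rearrangement ::
    "(ennreal \<Rightarrow> ennreal) \<Rightarrow> (real^'n \<Rightarrow> ennreal) \<Rightarrow> real \<Rightarrow> ennreal" where
  "weighted_rearrangement \<Phi> g t = orlicz_weight \<Phi> t * rearrangement g t"

lemma weighted_rearrangement_le_iff:
  assumes "young_function \<Phi>" "0 < t"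
  shows "weighted_rearrangement \<Phi> g t \<le> c
    \<longleftrightarrow> rearrangement g t \<le> gen_inverse \<Phi> (1 / ennreal t) * c"
proof (cases "gen_inverse \<Phi> (1 / ennreal t)")
  case (real r)
  then have "0 < r"
    using gen_inverse_reciprocal_bounds(1)[OF assms] by simp
  with real show ?thesis
    using ennreal_le_cmult_iff[of r "rearrangement g t" c]
    by (simp add: weighted_rearrangement_def orlicz_weight_def inverse_ennreal inverse_eq_divide)
qed (use gen_inverse_reciprocal_bounds(2)[OF assms] in simp)

lemma orlicz_lorentz_norm_infinity:
  "orlicz_lorentz_norm \<Phi> \<infinity> g = (SUP t\<in>{0<..}. weighted_rearrangement \<Phi> g t)"
  by (simp add: orlicz_lorentz_norm_def weighted_rearrangement_def orlicz_weight_def)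

lemma orlicz_lorentz_norm_finite:
  "q \<noteq> \<infinity> \<Longrightarrow> orlicz_lorentz_norm \<Phi> q g =
    ennpowr (\<integral>\<^sup>+t\<in>{0<..}. ennpowr (weighted_rearrangement \<Phi> g t) (enn2real q) / ennreal t \<partial>lborel)
      (1 / enn2real q)"
  by (simp add: orlicz_lorentz_norm_def weighted_rearrangement_def orlicz_weight_def)

text \<open>The weight is nondecreasing and the rearrangement nonincreasing, so all superlevel sets
  of either factor are intervals.\<close>

lemma measurable_weighted_rearrangement [measurable]:
  "weighted_rearrangement \<Phi> g \<in> borel_measurable borel"
proof -
  have [measurable]: "rearrangement g \<in> borel_measurable borel"
    by (intro measurable_antimono_real_ennreal rearrangement_antimono)
  have "{t. c < orlicz_weight \<Phi> t} \<in> sets borel" for c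
    by (intro real_interval_borel_measurable)
      (auto simp: is_interval_1 intro: less_le_trans orlicz_weight_mono)
  then have [measurable]: "orlicz_weight \<Phi> \<in> borel_measurable borel"
    by (intro borel_measurableI_greater) simp
  show ?thesis
    unfolding weighted_rearrangement_def by measurable
qed

text \<open>\<open>w t \<le> (K / 4)\<^sup>j w (t / K\<^sup>j)\<close> beats the factor \<open>K\<^sup>-\<^sup>j\<close> in the bound for the rearrangement of
  the maximal function; the resulting series in \<open>4\<^sup>-\<^sup>j\<close> is summed against \<open>2\<^sup>-\<^sup>j\<close>, so that only a
  supremum remains, which is compatible with every exponent \<open>q > 0\<close>.\<close>

lemma weighted_rearrangement_maximal_function_le:
  fixes f :: "real^'n \<Rightarrow> complex" and K :: real
  assumes [measurable]: "f \<in> borel_measurable lebesgue" and K: "4 < K" and t: "0 < t"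
    and growth: "\<And>t. 0 < t \<Longrightarrow> orlicz_weight \<Phi> (K * t) \<le> ennreal (K / 4) * orlicz_weight \<Phi> t"
  shows "weighted_rearrangement \<Phi> (maximal_function f) t
    \<le> ennreal (1 + (10 * real CARD('n)) ^ CARD('n) * K) *
        (SUP j. ennreal ((1 / 2) ^ j) * weighted_rearrangement \<Phi> (modulus f) (t / K ^ j))"
    (is "_ \<le> ennreal (1 + ?D * K) * ?S")
proof -
  let ?w = "orlicz_weight \<Phi>" and ?r = "rearrangement (modulus f)"
  let ?h = "weighted_rearrangement \<Phi> (modulus f)"
  have K0: "0 < K" using K by simp
  have w: "?w t \<le> ennreal ((K / 4) ^ j) * ?w (t / K ^ j)" for j
  proof (induction j)
    case (Suc j)
    have "?w (t / K ^ j) \<le> ennreal (K / 4) * ?w (t / K ^ Suc j)"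
      using growth[of "t / K ^ Suc j"] t K0 by simp
    then have "ennreal ((K / 4) ^ j) * ?w (t / K ^ j)
        \<le> ennreal ((K / 4) ^ j) * (ennreal (K / 4) * ?w (t / K ^ Suc j))"
      by (rule mult_left_mono) simp
    also have "\<dots> = ennreal ((K / 4) ^ Suc j) * ?w (t / K ^ Suc j)"
      using K0 by (simp add: mult.assoc[symmetric] ennreal_mult[symmetric] mult.commute)
    finally show ?case using Suc by order
  qed simp
  have S: "ennreal ((1 / 2) ^ j) * ?h (t / K ^ j) \<le> ?S" for j
    by (rule SUP_upper) simp
  have S0: "?h t \<le> ?S"
    using S[of 0] by (simp only: power_0 ennreal_1 mult_1 div_by_1)
  have summand: "?w t * (ennreal (1 / K ^ j) * ?r (t / K ^ Suc j)) \<le> ennreal (K * (1 / 2) ^ Suc j) * ?S" for j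
  proof -
    have "?w t * (ennreal (1 / K ^ j) * ?r (t / K ^ Suc j))
        \<le> ennreal ((K / 4) ^ Suc j) * ?w (t / K ^ Suc j) * (ennreal (1 / K ^ j) * ?r (t / K ^ Suc j))"
      using w[of "Suc j"] by (intro mult_right_mono) auto
    also have "\<dots> = ennreal ((K / 4) ^ Suc j * (1 / K ^ j)) * ?h (t / K ^ Suc j)"
      using K0 by (subst ennreal_mult) (auto simp: weighted_rearrangement_def mult_ac)
    \<comment> \<open>The dilation t / K^(j+1) is one step ahead of the damping K^(-j), which leaves
      a single factor K. The gain 4^(-(j+1)) is split into two copies of 2^(-(j+1)): one makes the
      series converge, the other enters the supremum.\<close>
    also have "(K / 4) ^ Suc j * (1 / K ^ j) = K * (1 / 2) ^ Suc j * (1 / 2) ^ Suc j"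
      using K0 by (simp add: field_simps power_mult_distrib[symmetric])
    also have "ennreal (K * (1 / 2) ^ Suc j * (1 / 2) ^ Suc j) * ?h (t / K ^ Suc j)
        = ennreal (K * (1 / 2) ^ Suc j) * (ennreal ((1 / 2) ^ Suc j) * ?h (t / K ^ Suc j))"
      using K0 by (subst ennreal_mult) (auto simp: mult.assoc)
    also have "\<dots> \<le> ennreal (K * (1 / 2) ^ Suc j) * ?S"
      by (intro mult_left_mono S) simp
    finally show ?thesis .
  qed
  have sums: "(\<lambda>j. K * (1 / 2) ^ Suc j) sums K"
    using sums_mult[OF power_half_series, of K] by simp
  have "?w t * (\<Sum>j. ennreal (1 / K ^ j) * ?r (t / K ^ Suc j))
      = (\<Sum>j. ?w t * (ennreal (1 / K ^ j) * ?r (t / K ^ Suc j)))"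
    by (rule ennreal_suminf_cmult[symmetric])
  also have "\<dots> \<le> (\<Sum>j. ennreal (K * (1 / 2) ^ Suc j) * ?S)"
    by (intro suminf_le summand) auto
  also have "\<dots> = (\<Sum>j. ennreal (K * (1 / 2) ^ Suc j)) * ?S"
    by (rule ennreal_suminf_multc)
  also have "(\<Sum>j. ennreal (K * (1 / 2) ^ Suc j)) = ennreal K"
    by (rule suminf_ennreal_eq[OF _ sums]) (use K0 in simp)
  finally have series: "?w t * (\<Sum>j. ennreal (1 / K ^ j) * ?r (t / K ^ Suc j)) \<le> ennreal K * ?S" .
  have "weighted_rearrangement \<Phi> (maximal_function f) t
      \<le> ?w t * (?r t + ennreal ?D * (\<Sum>j. ennreal (1 / K ^ j) * ?r (t / K ^ Suc j)))"
    unfolding weighted_rearrangement_def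
    by (intro mult_left_mono rearrangement_maximal_function_le t) (use K in auto)
  also have "\<dots> = ?h t + ennreal ?D * (?w t * (\<Sum>j. ennreal (1 / K ^ j) * ?r (t / K ^ Suc j)))"
    by (simp add: weighted_rearrangement_def distrib_left mult.left_commute)
  also have "\<dots> \<le> ?S + ennreal ?D * (ennreal K * ?S)"
    using S0 series by (intro add_mono mult_left_mono) auto
  also have "\<dots> = ennreal (1 + ?D * K) * ?S"
    using K0 by (subst ennreal_plus) (auto simp: distrib_right ennreal_mult mult.assoc)
  finally show ?thesis .
qed

text \<open>For finite q the power of the supremum is at most the sum of the powers, every dilate
  has the same integral with respect to dt / t, and the damping becomes a convergent geometric
  series.\<close>

lemma orlicz_lorentz_norm_le:
  fixes f :: "real^'n \<Rightarrow> ennreal" and g :: "real^'m \<Rightarrow> ennreal" and C K :: real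
  assumes q: "0 < q" and C: "0 < C" and K: "0 < K"
    and le: "\<And>t. 0 < t \<Longrightarrow> weighted_rearrangement \<Phi> g t
      \<le> ennreal C * (SUP j. ennreal ((1 / 2) ^ j) * weighted_rearrangement \<Phi> f (t / K ^ j))"
  shows "orlicz_lorentz_norm \<Phi> q g
    \<le> ennreal (if q = \<infinity> then C else C * (1 / (1 - (1 / 2) powr enn2real q)) powr (1 / enn2real q)) *
        orlicz_lorentz_norm \<Phi> q f"
proof (cases "q = \<infinity>")
  case True
  let ?h = "weighted_rearrangement \<Phi> f"
  have "weighted_rearrangement \<Phi> g t \<le> ennreal C * (SUP t\<in>{0<..}. ?h t)" if "0 < t" for t
  proof -
    \<comment> \<open>For infinite q, each dilated argument is still positive and the damping factor
      is at most 1.\<close>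
    have "ennreal ((1 / 2) ^ j) * ?h (t / K ^ j) \<le> 1 * (SUP t\<in>{0<..}. ?h t)" for j
      using that K by (intro mult_mono SUP_upper) (auto intro: power_le_one)
    then have "(SUP j. ennreal ((1 / 2) ^ j) * ?h (t / K ^ j)) \<le> (SUP t\<in>{0<..}. ?h t)"
      by (intro SUP_least) simp
    then show ?thesis
      using le[OF that] mult_left_mono[of _ _ "ennreal C"] by (meson order_trans zero_le)
  qed
  with True show ?thesis
    by (auto simp: orlicz_lorentz_norm_infinity[unfolded infinity_ennreal_def] intro!: SUP_least)
next
  case False
  define p where "p = enn2real q"
  have p: "0 < p"
    using q False by (simp add: p_def enn2real_positive_iff less_top)
  let ?h = "weighted_rearrangement \<Phi> f"
  define I where "I = (\<integral>\<^sup>+t\<in>{0<..}. ennpowr (?h t) p / ennreal t \<partial>lborel)"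
  \<comment> \<open>The ratio of the geometric series; it is below 1 for every p > 0.\<close>
  define a where "a = (1 / 2 :: real) powr p"
  have a: "0 < a" "a < 1"
    using p powr_less_mono2[of p "1 / 2" 1] by (auto simp: a_def)
  have pow: "((1 / 2 :: real) ^ j) powr p = a ^ j" for j
    by (simp add: a_def powr_power powr_realpow[symmetric] powr_powr mult.commute)
  have "ennpowr (weighted_rearrangement \<Phi> g t) p / ennreal t
      \<le> (\<Sum>j. ennreal (C powr p) * (ennreal (a ^ j) * (ennpowr (?h (t / K ^ j)) p / ennreal t)))"
    if "0 < t" for t
  proof -
    have "ennpowr (weighted_rearrangement \<Phi> g t) p
        \<le> ennreal (C powr p) * ennpowr (SUP j. ennreal ((1 / 2) ^ j) * ?h (t / K ^ j)) p"
      using ennpowr_mono[OF le[OF that] p] C by (simp add: ennpowr_cmult)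
    also have "\<dots> \<le> ennreal (C powr p) * (\<Sum>j. ennpowr (ennreal ((1 / 2) ^ j) * ?h (t / K ^ j)) p)"
      by (intro mult_left_mono ennpowr_SUP_le_suminf p) simp
    also have "\<dots> = (\<Sum>j. ennreal (C powr p) * (ennreal (a ^ j) * ennpowr (?h (t / K ^ j)) p))"
      by (simp add: ennpowr_cmult pow)
    finally have "ennpowr (weighted_rearrangement \<Phi> g t) p / ennreal t
        \<le> (\<Sum>j. ennreal (C powr p) * (ennreal (a ^ j) * ennpowr (?h (t / K ^ j)) p)) / ennreal t"
      by (rule divide_right_mono_ennreal)
    then show ?thesis
      by (simp add: divide_ennreal_def mult.assoc flip: ennreal_suminf_multc)
  qed
  then have "(\<integral>\<^sup>+t\<in>{0<..}. ennpowr (weighted_rearrangement \<Phi> g t) p / ennreal t \<partial>lborel)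
      \<le> (\<integral>\<^sup>+t. (\<Sum>j. ennreal (C powr p) * (ennreal (a ^ j) *
            (ennpowr (?h (t / K ^ j)) p / ennreal t * indicator {0<..} t))) \<partial>lborel)"
    by (intro nn_integral_mono) (auto simp: indicator_def)
  also have "\<dots> = (\<Sum>j. ennreal (C powr p) * (ennreal (a ^ j) *
            (\<integral>\<^sup>+t\<in>{0<..}. ennpowr (?h (t / K ^ j)) p / ennreal t \<partial>lborel)))"
    by (subst nn_integral_suminf) (auto simp: nn_integral_cmult)
  also have "\<dots> = (\<Sum>j. ennreal (C powr p) * (ennreal (a ^ j) * I))"
  proof -
    have "(\<integral>\<^sup>+t\<in>{0<..}. ennpowr (?h (t / K ^ j)) p / ennreal t \<partial>lborel) = I" for j
      unfolding I_def using K
      by (intro nn_integral_dilation_invariant[of "\<lambda>t. ennpowr (?h t) p"]) auto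
    then show ?thesis by simp
  qed
  also have "\<dots> = ennreal (C powr p) * (ennreal (1 / (1 - a)) * I)"
  proof -
    have "(\<Sum>j. ennreal (a ^ j)) = ennreal (1 / (1 - a))"
      using a by (intro suminf_ennreal_eq geometric_sums) auto
    then show ?thesis by simp
  qed
  also have "\<dots> = ennreal (C powr p * (1 / (1 - a))) * I"
    using a by (subst ennreal_mult) (auto simp: mult.assoc)
  finally have "orlicz_lorentz_norm \<Phi> q g \<le> ennpowr (ennreal (C powr p * (1 / (1 - a))) * I) (1 / p)"
    unfolding orlicz_lorentz_norm_finite[OF False] p_def[symmetric]
    using p by (intro ennpowr_mono) auto
  also have "\<dots> = ennreal ((C powr p * (1 / (1 - a))) powr (1 / p)) * ennpowr I (1 / p)"
    using a C by (intro ennpowr_cmult) (auto intro!: divide_pos_pos)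
  also have "(C powr p * (1 / (1 - a))) powr (1 / p) = C * (1 / (1 - a)) powr (1 / p)"
    using a C p by (simp only: powr_mult powr_powr) simp
  finally show ?thesis
    using False by (simp add: orlicz_lorentz_norm_finite p_def[symmetric] I_def a_def)
qed

section \<open>The weak Orlicz quasi-norm\<close>

lemma distr_fun_divide:
  assumes "0 < l" "0 \<le> s"
  shows "distr_fun (\<lambda>x. g x / ennreal l) s = distr_fun g (l * s)"
proof -
  have "ennreal s < y / ennreal l \<longleftrightarrow> ennreal (l * s) < y" for y
  proof -
    have "y / ennreal l = ennreal (1 / l) * y"
      using assms divide_ennreal[of 1 l]
      by (metis ennreal_1 ennreal_times_divide mult.commute mult.right_neutral zero_le_one)
    then show ?thesis
      using ennreal_le_cmult_iff[of l y "ennreal s"] assms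
      by (simp add: not_le[symmetric] ennreal_mult)
  qed
  then show ?thesis by (simp add: distr_fun_def)
qed

text \<open>For s above the generalized inverse G at 1/t, \<Phi>(s) > 1/t, so the weak bound forces
  the distribution function at l * s to be at most t, and the rearrangement at t is at most l * s.
  Letting s decrease to G gives the claim.\<close>

lemma weighted_rearrangement_le_of_weak:
  fixes g :: "real^'n \<Rightarrow> ennreal"
  assumes \<Phi>: "young_function \<Phi>" and t: "0 < t" and l: "0 < l"
    and le: "weak_orlicz_sup \<Phi> (\<lambda>x. g x / ennreal l) \<le> 1"
  shows "weighted_rearrangement \<Phi> g t \<le> ennreal l"
proof -
  have u: "1 / ennreal t = ennreal (1 / t)"
    using divide_ennreal[of 1 t] t by simp
  define G where "G = gen_inverse \<Phi> (1 / ennreal t)"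
  have G: "0 < G" "G < \<infinity>"
    using gen_inverse_reciprocal_bounds[OF \<Phi> t] by (simp_all add: G_def)
  have bound: "rearrangement g t \<le> ennreal l * ennreal s" if s: "G < ennreal s" for s
  proof -
    have s0: "0 < s"
      using s G(1) by (metis ennreal_less_zero_iff order.strict_trans)
    obtain r where "\<Phi> r > 1 / ennreal t" "r < ennreal s"
      using s u unfolding G_def gen_inverse_def by (auto simp: Inf_less_iff)
    then have big: "ennreal (1 / t) < \<Phi> (ennreal s)"
      using \<Phi> u by (auto simp: young_function_def dest: monoD[of \<Phi> r "ennreal s"])
    have "\<Phi> (ennreal s) * distr_fun g (l * s) \<le> 1"
      using le SUP_upper[of s "{0<..}" "\<lambda>s. \<Phi> (ennreal s) * distr_fun (\<lambda>x. g x / ennreal l) s"] s0 l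
      by (simp add: weak_orlicz_sup_def distr_fun_divide)
    then have "ennreal (1 / t) * distr_fun g (l * s) \<le> 1"
      using big mult_right_mono[of "ennreal (1 / t)"] by (meson less_imp_le order_trans zero_le)
    then have "distr_fun g (l * s) \<le> ennreal t"
      using ennreal_le_cmult_iff[of t "distr_fun g (l * s)" 1] t by simp
    then show ?thesis
      using rearrangement_le[of "l * s" g t] s0 l by (simp add: ennreal_mult)
  qed
  have "ennreal (1 / l) * rearrangement g t \<le> G"
  proof (rule dense_ge)
    fix z assume z: "G < z"
    show "ennreal (1 / l) * rearrangement g t \<le> z"
    proof (cases z)
      case (real s)
      then show ?thesis
        using bound[of s] z ennreal_le_cmult_iff[OF l] by simp
    qed simp
  qed
  then have "rearrangement g t \<le> ennreal l * G"
    using ennreal_le_cmult_iff[OF l] by blast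
  then show ?thesis
    using weighted_rearrangement_le_iff[OF \<Phi> t, of g] by (simp add: G_def mult.commute)
qed

text \<open>The factor 2 provides the strict inequality that would otherwise come from left continuity of \<open>\<Phi>\<close>.\<close>

lemma weak_orlicz_norm_le_of_weighted_rearrangement:
  fixes g :: "real^'n \<Rightarrow> ennreal"
  assumes [measurable]: "g \<in> borel_measurable lebesgue"
    and \<Phi>: "young_function \<Phi>" and l: "0 < l"
    and le: "\<And>t. 0 < t \<Longrightarrow> weighted_rearrangement \<Phi> g t \<le> ennreal l"
  shows "weak_orlicz_norm \<Phi> g \<le> ennreal (2 * l)"
proof -
  have "\<Phi> (ennreal s) * distr_fun g (2 * l * s) \<le> 1" if s: "0 < s" for s
  proof (rule ccontr)
    assume "\<not> ?thesis"
    then have big: "1 < \<Phi> (ennreal s) * distr_fun g (2 * l * s)"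
      by simp
    \<comment> \<open>The product of \<Phi>(s) and its reciprocal is at most 1 also when \<Phi>(s)
      is 0 or infinite, by the convention 0 * \<infinity> = 0.\<close>
    have "inverse (\<Phi> (ennreal s)) < distr_fun g (2 * l * s)"
    proof (rule ccontr)
      assume "\<not> ?thesis"
      then have "\<Phi> (ennreal s) * distr_fun g (2 * l * s) \<le> \<Phi> (ennreal s) * inverse (\<Phi> (ennreal s))"
        by (intro mult_left_mono) auto
      also have "\<dots> \<le> 1"
      proof (cases "\<Phi> (ennreal s)")
        case (real r)
        then show ?thesis
          by (cases "r = 0") (auto simp: inverse_ennreal ennreal_mult[symmetric])
      qed simp
      finally show False
        using big by simp
    qed
    \<comment> \<open>A value t strictly between 1 / \<Phi>(s) and the distribution function at 2ls
      serves two purposes: the inverse of \<Phi> at 1/t is at most s, whereas the rearrangement at t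
      is at least 2ls. The hypothesis bounds the latter by ls, a contradiction.\<close>
    then obtain y where y: "inverse (\<Phi> (ennreal s)) < y" "y < distr_fun g (2 * l * s)"
      using dense by blast
    obtain t where t: "y = ennreal t" "0 < t"
    proof (cases y)
      case (real t)
      with y(1) have "t \<noteq> 0" by auto
      with real that show ?thesis by simp
    qed (use y(2) in simp)
    have u: "1 / ennreal t = ennreal (1 / t)"
      using divide_ennreal[of 1 t] t by simp
    define G where "G = gen_inverse \<Phi> (1 / ennreal t)"
    have "ennreal (1 / t) < \<Phi> (ennreal s)"
    proof (cases "\<Phi> (ennreal s)")
      case (real r)
      then have "r \<noteq> 0"
        using y(1) by auto
      with real y(1) t show ?thesis
        by (simp add: inverse_ennreal ennreal_less_iff field_simps)
    qed simp
    then have "G \<le> ennreal s"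
      unfolding G_def gen_inverse_def u by (auto intro!: Inf_lower)
    have "ennreal (2 * l * s) \<le> rearrangement g t"
      unfolding rearrangement_def
    proof (rule INF_greatest)
      fix \<alpha> assume "\<alpha> \<in> {\<alpha>. 0 < \<alpha> \<and> distr_fun g \<alpha> \<le> ennreal t}"
      then have \<alpha>: "0 < \<alpha>" "distr_fun g \<alpha> \<le> ennreal t"
        by auto
      show "ennreal (2 * l * s) \<le> ennreal \<alpha>"
      proof (rule ccontr)
        assume "\<not> ?thesis"
        then have "distr_fun g (2 * l * s) \<le> distr_fun g \<alpha>"
          unfolding distr_fun_def using borel_measurable_less[of "\<lambda>_. ennreal \<alpha>" lebesgue g]
          by (intro emeasure_mono) (auto intro: less_trans)
        with \<alpha>(2) y(2) t(1) show False by order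
      qed
    qed
    also have "rearrangement g t \<le> ennreal l * G"
      using le[OF t(2)] weighted_rearrangement_le_iff[OF \<Phi> t(2), of g] by (simp add: G_def mult.commute)
    also have "\<dots> \<le> ennreal l * ennreal s"
      using \<open>G \<le> ennreal s\<close> by (rule mult_left_mono) simp
    finally show False
      using l s by (simp add: ennreal_mult[symmetric])
  qed
  then have "weak_orlicz_sup \<Phi> (\<lambda>x. g x / ennreal (2 * l)) \<le> 1"
    using l unfolding weak_orlicz_sup_def by (intro SUP_least) (simp add: distr_fun_divide)
  then show ?thesis
    using l unfolding weak_orlicz_norm_def by (intro INF_lower) simp
qed

section \<open>Boundedness on the Orlicz-Lorentz and weak Orlicz spaces\<close>

theorem theorem4p11:
  fixes \<Phi> :: "ennreal \<Rightarrow> ennreal" and q :: ennreal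
  assumes "0 < q" and "young_function \<Phi>" and "nabla2 \<Phi>"
  shows "(\<exists>C::real. C > 0 \<and> (\<forall>f :: real^'n \<Rightarrow> complex. f \<in> orlicz_lorentz \<Phi> q \<longrightarrow>
            maximal_function f \<in> borel_measurable lebesgue \<and>
            orlicz_lorentz_norm \<Phi> q (maximal_function f)
              \<le> ennreal C * orlicz_lorentz_norm \<Phi> q (modulus f)))
       \<and> (\<exists>C::real. C > 0 \<and> (\<forall>f :: real^'n \<Rightarrow> complex. f \<in> weak_orlicz \<Phi> \<longrightarrow>
            maximal_function f \<in> borel_measurable lebesgue \<and>
            weak_orlicz_norm \<Phi> (maximal_function f)
              \<le> ennreal C * weak_orlicz_norm \<Phi> (modulus f)))"
proof -
  obtain K :: real where K: "4 < K"
    "\<And>t. 0 < t \<Longrightarrow> orlicz_weight \<Phi> (K * t) \<le> ennreal (K / 4) * orlicz_weight \<Phi> t"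
    using orlicz_weight_growth assms(2,3) by blast
  define C where "C = 1 + (10 * real CARD('n)) ^ CARD('n) * K"
  have C: "0 < C"
    using K(1) unfolding C_def by (intro add_pos_nonneg) auto
  have pointwise: "weighted_rearrangement \<Phi> (maximal_function f) t
      \<le> ennreal C * (SUP j. ennreal ((1 / 2) ^ j) * weighted_rearrangement \<Phi> (modulus f) (t / K ^ j))"
    if "f \<in> borel_measurable lebesgue" "0 < t" for f :: "real^'n \<Rightarrow> complex" and t
    unfolding C_def by (rule weighted_rearrangement_maximal_function_le[OF that(1) K(1) that(2) K(2)])
  have strong: "orlicz_lorentz_norm \<Phi> r (maximal_function f)
      \<le> ennreal (if r = \<infinity> then C else C * (1 / (1 - (1 / 2) powr enn2real r)) powr (1 / enn2real r)) *
          orlicz_lorentz_norm \<Phi> r (modulus f)"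
    if "0 < r" "f \<in> borel_measurable lebesgue" for r and f :: "real^'n \<Rightarrow> complex"
    using K(1) by (intro orlicz_lorentz_norm_le[OF that(1) C _ pointwise[OF that(2)]]) auto
  define C' where "C' = (if q = \<infinity> then C else C * (1 / (1 - (1 / 2) powr enn2real q)) powr (1 / enn2real q))"
  have "0 < C'"
  proof (cases "q = \<infinity>")
    case False
    then have "0 < enn2real q"
      using assms(1) by (simp add: enn2real_positive_iff less_top)
    then have "(1 / 2) powr enn2real q < 1"
      using powr_less_mono2[of "enn2real q" "1 / 2" 1] by simp
    then have "0 < (1 / (1 - (1 / 2) powr enn2real q)) powr (1 / enn2real q)"
      unfolding powr_gt_zero using \<open>0 < enn2real q\<close> by simp
    with False C show ?thesis by (simp add: C'_def)
  qed (simp add: C'_def C)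
  moreover have "weak_orlicz_norm \<Phi> (maximal_function f) \<le> ennreal (2 * C) * weak_orlicz_norm \<Phi> (modulus f)"
    if f: "f \<in> borel_measurable lebesgue" for f :: "real^'n \<Rightarrow> complex"
  proof -
    \<comment> \<open>Every l admissible for f bounds the quasi-norm with infinite q. The maximal
      function inherits the bound C * l there, and returning to the weak quasi-norm costs a factor
      2.\<close>
    have "weak_orlicz_norm \<Phi> (maximal_function f) \<le> ennreal (2 * C) * ennreal l"
      if l: "0 < l" "weak_orlicz_sup \<Phi> (\<lambda>x. modulus f x / ennreal l) \<le> 1" for l
    proof -
      have "orlicz_lorentz_norm \<Phi> \<infinity> (modulus f) \<le> ennreal l"
        unfolding orlicz_lorentz_norm_infinity
        using l weighted_rearrangement_le_of_weak[OF assms(2)] by (intro SUP_least) auto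
      then have "orlicz_lorentz_norm \<Phi> \<infinity> (maximal_function f) \<le> ennreal (C * l)"
        using strong[of \<infinity> f] f C l mult_left_mono[of _ "ennreal l" "ennreal C"]
        by (fastforce simp: ennreal_mult intro: order_trans)
      then have "weighted_rearrangement \<Phi> (maximal_function f) t \<le> ennreal (C * l)" if "0 < t" for t
        using that unfolding orlicz_lorentz_norm_infinity by (auto simp: SUP_le_iff)
      then have "weak_orlicz_norm \<Phi> (maximal_function f) \<le> ennreal (2 * (C * l))"
        using C l by (intro weak_orlicz_norm_le_of_weighted_rearrangement[OF measurable_maximal_function assms(2)]) auto
      then show ?thesis
        using C l by (simp add: ennreal_mult mult.assoc)
    qed
    \<comment> \<open>The constant is moved to the left so that the right side is the bare infimum
      over admissible l, to which the bound for each l applies.\<close>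
    then have "ennreal (1 / (2 * C)) * weak_orlicz_norm \<Phi> (maximal_function f) \<le> weak_orlicz_norm \<Phi> (modulus f)"
      using C unfolding weak_orlicz_norm_def[of \<Phi> "modulus f"]
      by (intro INF_greatest) (use ennreal_le_cmult_iff[of "2 * C"] in auto)
    then show ?thesis
      using ennreal_le_cmult_iff[of "2 * C"] C by simp
  qed
  ultimately show ?thesis
    using strong[OF assms(1)] C
    by (intro conjI exI[of _ C'] exI[of _ "2 * C"])
      (auto simp: orlicz_lorentz_def weak_orlicz_def C'_def)
qed

end
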